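(* Suppose $G\curvearrowright X$ is a transitive Polish group action and that $\phi\colon X\to H$ is a Baire measurable function with values in a Polish group $H$. Then the following conditions are equivalent. (1) $\phi$ is continuous. (2) $d\phi\colon G\times X\to H$ is continuous. (3) There is a comeagre set of $g\in G$ such that $d_g\phi$ is continuous. (4) For every proper subgroup $F<G$, there is some $g\in G\setminus F$ such that $d_g\phi$ is continuous. (5) For any infinite sequence $g_1,g_2,\ldots\in G$, there is some $n$ such that $d_{g_n}d_{g_{n-1}}\cdots d_{g_1}\phi$ is continuous.
   Context: A Polish group action $G\curvearrowright X$ is an action of a Polish group $G$ on a Polish space $X$ such that the action map $G\times X\to X$ is jointly continuous. A map between topological spaces is Baire measurable if the inverse image of every open set has the Baire property (i.e. differs from an open set by a meagre set). For a function $\phi\colon X\to H$ into a group $H$, the differential $d\phi\colon G\times X\to H$ is defined by $d\phi(g,x)=\phi(gx)^{-1}\phi(x)$. For $g\in G$, the directional differential $d_g\phi\colon X\to H$ is the function $d_g\phi(x)=d\phi(g,x)=\phi(gx)^{-1}\phi(x)$. Since $d_g\phi$ is again a function from $X$ to $H$, the operation can be iterated: $d_fd_g\phi=d_f(d_g\phi)$, so that $d_fd_g\phi(x)=\phi(fx)^{-1}\phi(gfx)\phi(gx)^{-1}\phi(x)$, and so on. *)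

theory Defs
  imports "HOL-Analysis.Analysis" "HOL-Algebra.Group_Action"
begin

text \<open>
  Groups are those of \<^theory>\<open>HOL-Algebra.Group\<close>; a topology on a group \<open>G\<close> is a separate
  abstract topology whose underlying set is \<open>carrier G\<close>.
\<close>

subsection \<open>Baire category in abstract topological spaces\<close>

definition nowhere_dense_in :: "'a topology \<Rightarrow> 'a set \<Rightarrow> bool" where
  "nowhere_dense_in T S \<longleftrightarrow> S \<subseteq> topspace T \<and> T interior_of (T closure_of S) = {}"

definition meagre_in :: "'a topology \<Rightarrow> 'a set \<Rightarrow> bool" where
  "meagre_in T S \<longleftrightarrow> (\<exists>\<N>. countable \<N> \<and> (\<forall>N\<in>\<N>. nowhere_dense_in T N) \<and> S = \<Union>\<N>)"

definition comeagre_in :: "'a topology \<Rightarrow> 'a set \<Rightarrow> bool" where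
  "comeagre_in T S \<longleftrightarrow> S \<subseteq> topspace T \<and> meagre_in T (topspace T - S)"

definition baire_property_in :: "'a topology \<Rightarrow> 'a set \<Rightarrow> bool" where
  "baire_property_in T S \<longleftrightarrow>
     S \<subseteq> topspace T \<and> (\<exists>U. openin T U \<and> meagre_in T ((S - U) \<union> (U - S)))"

definition baire_measurable_map :: "'a topology \<Rightarrow> 'b topology \<Rightarrow> ('a \<Rightarrow> 'b) \<Rightarrow> bool" where
  "baire_measurable_map X Y f \<longleftrightarrow>
     f \<in> topspace X \<rightarrow> topspace Y \<and>
     (\<forall>U. openin Y U \<longrightarrow> baire_property_in X {x \<in> topspace X. f x \<in> U})"

subsection \<open>Polish groups and Polish group actions\<close>

definition polish_topology :: "'a topology \<Rightarrow> bool" where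
  "polish_topology T \<longleftrightarrow> completely_metrizable_space T \<and> second_countable T"

locale polish_group = group G for G (structure) +
  fixes T
  assumes topspace_eq_carrier: "topspace T = carrier G"
    and polish: "polish_topology T"
    and continuous_mult: "continuous_map (prod_topology T T) T (\<lambda>(x, y). x \<otimes> y)"
    and continuous_inv: "continuous_map T T (\<lambda>x. inv x)"

locale polish_group_action =
  polish_group G T + group_action G "topspace X" \<alpha>
  for G (structure) and T and X and \<alpha> +
  assumes polish_space: "polish_topology X"
    and continuous_action: "continuous_map (prod_topology T X) X (\<lambda>(g, x). \<alpha> g x)"

subsection \<open>Differentials\<close>

definition differential ::
    "('h, 'm) monoid_scheme \<Rightarrow> ('g \<Rightarrow> 'x \<Rightarrow> 'x) \<Rightarrow> ('x \<Rightarrow> 'h) \<Rightarrow> 'g \<times> 'x \<Rightarrow> 'h" where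
  "differential H \<alpha> \<phi> = (\<lambda>(g, x). inv\<^bsub>H\<^esub> (\<phi> (\<alpha> g x)) \<otimes>\<^bsub>H\<^esub> \<phi> x)"

definition directional_differential ::
    "('h, 'm) monoid_scheme \<Rightarrow> ('g \<Rightarrow> 'x \<Rightarrow> 'x) \<Rightarrow> 'g \<Rightarrow> ('x \<Rightarrow> 'h) \<Rightarrow> 'x \<Rightarrow> 'h" where
  "directional_differential H \<alpha> g \<phi> = (\<lambda>x. differential H \<alpha> \<phi> (g, x))"

text \<open>
  The \<open>n\<close>-fold differential along \<open>g 1, \<dots>, g n\<close>, with \<open>g 1\<close> applied first. The sequence is
  indexed from \<open>1\<close>: the value \<open>g 0\<close> is never used.
\<close>

primrec iterated_differential ::
    "('h, 'm) monoid_scheme \<Rightarrow> ('g \<Rightarrow> 'x \<Rightarrow> 'x) \<Rightarrow> (nat \<Rightarrow> 'g) \<Rightarrow> nat \<Rightarrow> ('x \<Rightarrow> 'h) \<Rightarrow> 'x \<Rightarrow> 'h" where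
  "iterated_differential H \<alpha> g 0 \<phi> = \<phi>"
| "iterated_differential H \<alpha> g (Suc n) \<phi> =
     directional_differential H \<alpha> (g (Suc n)) (iterated_differential H \<alpha> g n \<phi>)"

end

theory Submission
  imports Defs
begin

text \<open>
  The heart of the matter is that a Baire measurable \<open>\<phi>\<close> all of whose directional differentials
  \<open>d\<^sub>g \<phi>\<close> are continuous is itself continuous (\<open>continuous_if_all_D_continuous\<close>). Such a \<open>\<phi>\<close> is
  continuous on a comeagre set \<open>C\<close>. Given \<open>x\<^sub>n \<longlonglongrightarrow> x\<close>, one looks for a single \<open>g\<close> moving \<open>x\<close> and
  all the \<open>x\<^sub>n\<close> into \<open>C\<close>. Then \<open>\<phi> (g x\<^sub>n)\<close> converges to \<open>\<phi> (g x)\<close>, and the continuous correction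
  \<open>\<phi> y = \<phi> (g y) \<cdot> d\<^sub>g \<phi> y\<close> carries this back to \<open>\<phi> x\<^sub>n \<longlonglongrightarrow> \<phi> x\<close>.

  Such a \<open>g\<close> exists by the Baire category theorem in \<open>G\<close>, since for every point \<open>y\<close> the set of
  \<open>g\<close> with \<open>g y \<in> C\<close> is comeagre (\<open>comeagre_return_set\<close>). This is a Kuratowski--Ulam argument: for
  dense open \<open>U \<subseteq> X\<close> and nonempty open \<open>V \<subseteq> G\<close>, the points that some \<open>g \<in> V\<close> moves into \<open>U\<close>
  form a dense open set. Running through countably many \<open>U\<close> and \<open>V\<close> gives one point \<open>x\<close> with
  comeagre return set, and transitivity transports this to every other point by a right
  translation of \<open>G\<close>.

  The rest is algebra. By the cocycle identity
  \<open>d\<^sub>g\<^sub>h \<phi> x = d\<^sub>g \<phi> (h x) \<cdot> d\<^sub>h \<phi> x\<close>, the directions \<open>g\<close> with \<open>d\<^sub>g \<phi>\<close> continuous form a subgroup.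
  If every proper subgroup misses some direction of continuity, this subgroup must be all of \<open>G\<close>,
  which is the situation just treated. A comeagre set of directions of continuity is a special
  case, because a comeagre set lies in no proper subgroup. For iterated differentials, suppose \<open>\<phi>\<close>
  is discontinuous. Then some \<open>d\<^sub>g \<phi>\<close> is discontinuous and again continuous on a comeagre set, so
  the choice of \<open>g\<close> can be repeated forever. This gives a sequence of directions along which no
  iterated differential is continuous.
\<close>

section \<open>Comeagre sets\<close>

lemma nowhere_dense_in_iff:
  "nowhere_dense_in T S \<longleftrightarrow>
     S \<subseteq> topspace T \<and> T closure_of (topspace T - T closure_of S) = topspace T"
  using closure_of_complement[of T "T closure_of S"] interior_of_subset_topspace[of T "T closure_of S"]
  by (auto simp: nowhere_dense_in_def)

lemma nowhere_dense_in_subset: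
  "nowhere_dense_in T S \<Longrightarrow> S' \<subseteq> S \<Longrightarrow> nowhere_dense_in T S'"
  using interior_of_mono[OF closure_of_mono, of S' S T T] unfolding nowhere_dense_in_def by blast

text \<open>
  The Baire category theorem and preimages are handled most easily through dense open sets, so
  comeagre sets are used in this form from here on.
\<close>

lemma comeagre_in_iff:
  "comeagre_in T S \<longleftrightarrow> S \<subseteq> topspace T \<and>
     (\<exists>\<U>. countable \<U> \<and> (\<forall>U\<in>\<U>. openin T U \<and> T closure_of U = topspace T) \<and>
          topspace T \<inter> \<Inter>\<U> \<subseteq> S)"
proof (intro iffI conjI)
  assume S: "comeagre_in T S"
  then show "S \<subseteq> topspace T"
    by (simp add: comeagre_in_def)
  obtain \<N> where \<N>: "countable \<N>" "\<And>N. N \<in> \<N> \<Longrightarrow> nowhere_dense_in T N"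
    "topspace T - S = \<Union>\<N>"
    using S by (auto simp: comeagre_in_def meagre_in_def)
  let ?\<U> = "(\<lambda>N. topspace T - T closure_of N) ` \<N>"
  have "topspace T \<inter> \<Inter>?\<U> \<subseteq> S"
  proof
    fix x assume x: "x \<in> topspace T \<inter> \<Inter>?\<U>"
    have "N \<subseteq> T closure_of N" if "N \<in> \<N>" for N
      using that \<N>(2) by (simp add: closure_of_subset nowhere_dense_in_def)
    with x have "x \<notin> \<Union>\<N>"
      by blast
    with x \<N>(3) show "x \<in> S"
      by blast
  qed
  moreover have "\<forall>U\<in>?\<U>. openin T U \<and> T closure_of U = topspace T"
    using \<N>(2) by (simp add: nowhere_dense_in_iff openin_diff)
  ultimately show "\<exists>\<U>. countable \<U> \<and> (\<forall>U\<in>\<U>. openin T U \<and> T closure_of U = topspace T) \<and>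
          topspace T \<inter> \<Inter>\<U> \<subseteq> S"
    using \<N>(1) by blast
next
  assume "S \<subseteq> topspace T \<and>
     (\<exists>\<U>. countable \<U> \<and> (\<forall>U\<in>\<U>. openin T U \<and> T closure_of U = topspace T) \<and>
          topspace T \<inter> \<Inter>\<U> \<subseteq> S)"
  then obtain \<U> where S: "S \<subseteq> topspace T" and \<U>: "countable \<U>"
    "\<And>U. U \<in> \<U> \<Longrightarrow> openin T U \<and> T closure_of U = topspace T" "topspace T \<inter> \<Inter>\<U> \<subseteq> S"
    by blast
  let ?\<N> = "(\<lambda>U. (topspace T - U) - S) ` \<U>"
  have "nowhere_dense_in T (topspace T - U)" if "U \<in> \<U>" for U
    using \<U>(2)[OF that] by (simp add: nowhere_dense_in_def closure_of_complement interior_of_complement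
        interior_of_openin)
  then have "nowhere_dense_in T N" if "N \<in> ?\<N>" for N
    using that nowhere_dense_in_subset by (metis (no_types, lifting) Diff_subset imageE)
  moreover have "topspace T - S = \<Union>?\<N>"
    using \<U>(3) by blast
  moreover have "countable ?\<N>"
    using \<U>(1) by simp
  ultimately have "meagre_in T (topspace T - S)"
    unfolding meagre_in_def by (intro exI[of _ ?\<N>]) simp
  with S show "comeagre_in T S"
    by (simp add: comeagre_in_def)
qed

lemma comeagre_in_open_dense:
  "openin T U \<Longrightarrow> T closure_of U = topspace T \<Longrightarrow> comeagre_in T U"
  unfolding comeagre_in_iff using openin_subset by (intro conjI exI[of _ "{U}"]) auto

lemma comeagre_in_topspace: "comeagre_in T (topspace T)"
  by (simp add: comeagre_in_open_dense)

lemma comeagre_in_mono: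
  "comeagre_in T S \<Longrightarrow> S \<subseteq> S' \<Longrightarrow> S' \<subseteq> topspace T \<Longrightarrow> comeagre_in T S'"
  unfolding comeagre_in_iff by (meson order_trans)

lemma comeagre_in_countable_INT:
  assumes "countable I" and "\<And>i. i \<in> I \<Longrightarrow> comeagre_in T (S i)"
  shows "comeagre_in T (topspace T \<inter> (\<Inter>i\<in>I. S i))"
proof -
  have "\<forall>i\<in>I. \<exists>\<U>. countable \<U> \<and> (\<forall>U\<in>\<U>. openin T U \<and> T closure_of U = topspace T) \<and>
      topspace T \<inter> \<Inter>\<U> \<subseteq> S i"
    using assms(2) unfolding comeagre_in_iff by blast
  from bchoice[OF this] obtain \<U> where \<U>: "\<forall>i\<in>I. countable (\<U> i) \<and>
      (\<forall>U\<in>\<U> i. openin T U \<and> T closure_of U = topspace T) \<and> topspace T \<inter> \<Inter>(\<U> i) \<subseteq> S i"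
    by blast
  have "countable (\<Union>i\<in>I. \<U> i)"
    using assms(1) \<U> by (intro countable_UN) auto
  moreover have "\<forall>U\<in>(\<Union>i\<in>I. \<U> i). openin T U \<and> T closure_of U = topspace T"
  proof
    fix U assume "U \<in> (\<Union>i\<in>I. \<U> i)"
    then show "openin T U \<and> T closure_of U = topspace T"
      using bspec[OF \<U>] by (elim UN_E) blast
  qed
  moreover have "topspace T \<inter> \<Inter>(\<Union>i\<in>I. \<U> i) \<subseteq> topspace T \<inter> (\<Inter>i\<in>I. S i)"
  proof
    fix x assume x: "x \<in> topspace T \<inter> \<Inter>(\<Union>i\<in>I. \<U> i)"
    have "x \<in> S i" if "i \<in> I" for i
      using x that bspec[OF \<U> that] by auto
    with x show "x \<in> topspace T \<inter> (\<Inter>i\<in>I. S i)"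
      by blast
  qed
  ultimately show ?thesis
    unfolding comeagre_in_iff by (intro conjI exI[of _ "\<Union>i\<in>I. \<U> i"] Int_lower1)
qed

lemma comeagre_in_Int:
  assumes "comeagre_in T A" "comeagre_in T B"
  shows "comeagre_in T (A \<inter> B)"
proof -
  have "comeagre_in T (topspace T \<inter> (\<Inter>i\<in>{A, B}. i))"
    by (rule comeagre_in_countable_INT) (use assms in auto)
  moreover have "topspace T \<inter> (\<Inter>i\<in>{A, B}. i) = A \<inter> B"
    using assms by (auto simp: comeagre_in_def)
  ultimately show ?thesis
    by simp
qed

lemma comeagre_in_nonempty:
  assumes "completely_metrizable_space T" "topspace T \<noteq> {}" "comeagre_in T S"
  shows "S \<noteq> {}"
proof
  assume "S = {}"
  then obtain \<U> where \<U>: "countable \<U>"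
    "\<And>U. U \<in> \<U> \<Longrightarrow> openin T U \<and> T closure_of U = topspace T" "topspace T \<inter> \<Inter>\<U> = {}"
    using assms(3) unfolding comeagre_in_iff by blast
  have "T closure_of \<Inter>\<U> = topspace T"
    by (rule Baire_category) (use assms(1) \<U> in auto)
  then have "topspace T = {}"
    using \<U>(3) by (metis closure_of_empty closure_of_restrict)
  with assms(2) show False
    by simp
qed

text \<open>
  Continuity pulls open sets back to open sets, and openness pulls dense sets back to dense sets.
\<close>

lemma comeagre_in_preimage:
  assumes f: "continuous_map X Y f" "open_map X Y f" and S: "comeagre_in Y S"
  shows "comeagre_in X {x \<in> topspace X. f x \<in> S}"
proof -
  obtain \<U> where \<U>: "countable \<U>"
    "\<And>U. U \<in> \<U> \<Longrightarrow> openin Y U \<and> Y closure_of U = topspace Y" "topspace Y \<inter> \<Inter>\<U> \<subseteq> S"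
    using S unfolding comeagre_in_iff by blast
  let ?pre = "\<lambda>U. {x \<in> topspace X. f x \<in> U}"
  have fX: "f x \<in> topspace Y" if "x \<in> topspace X" for x
    using f(1) that by (auto simp: continuous_map_def)
  have "openin X (?pre U) \<and> X closure_of ?pre U = topspace X" if "U \<in> \<U>" for U
  proof
    show "openin X (?pre U)"
      using \<U>(2)[OF that] f(1) by (simp add: openin_continuous_map_preimage)
    show "X closure_of ?pre U = topspace X"
      unfolding dense_intersects_open
    proof (intro allI impI)
      fix V assume V: "openin X V \<and> V \<noteq> {}"
      then have "openin Y (f ` V)" "f ` V \<noteq> {}"
        using f(2) by (auto simp: open_map_def)
      then have "U \<inter> f ` V \<noteq> {}"
        using \<U>(2)[OF that] unfolding dense_intersects_open by blast
      then show "?pre U \<inter> V \<noteq> {}"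
        using V openin_subset by blast
    qed
  qed
  moreover have "topspace X \<inter> \<Inter>(?pre ` \<U>) \<subseteq> ?pre S"
    using \<U>(3) fX by blast
  ultimately show ?thesis
    unfolding comeagre_in_iff using \<U>(1)
    by (intro conjI exI[of _ "?pre ` \<U>"]) auto
qed

text \<open>
  For each of the countably many basic open \<open>V\<close>, the preimage of \<open>V\<close> agrees with an open set off a
  meagre set. Off the union of these meagre sets, all preimages become relatively open.
\<close>

lemma baire_measurable_imp_continuous_on_comeagre:
  assumes "second_countable Y" and f: "baire_measurable_map X Y f"
  obtains C where "comeagre_in X C" "continuous_map (subtopology X C) Y f"
proof -
  obtain \<B> where \<B>: "countable \<B>" "\<And>V. V \<in> \<B> \<Longrightarrow> openin Y V"
    "\<And>U y. openin Y U \<Longrightarrow> y \<in> U \<Longrightarrow> \<exists>V\<in>\<B>. y \<in> V \<and> V \<subseteq> U"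
    using assms(1) unfolding second_countable_def by metis
  let ?pre = "\<lambda>V. {x \<in> topspace X. f x \<in> V}"
  have "\<forall>V\<in>\<B>. \<exists>U. openin X U \<and> meagre_in X ((?pre V - U) \<union> (U - ?pre V))"
    using f \<B>(2) by (simp add: baire_measurable_map_def baire_property_in_def)
  from bchoice[OF this] obtain U where U: "\<And>V. V \<in> \<B> \<Longrightarrow> openin X (U V)"
    "\<And>V. V \<in> \<B> \<Longrightarrow> meagre_in X ((?pre V - U V) \<union> (U V - ?pre V))"
    by auto
  define D where "D V = topspace X - ((?pre V - U V) \<union> (U V - ?pre V))" for V
  define C where "C = topspace X \<inter> (\<Inter>V\<in>\<B>. D V)"
  have "comeagre_in X (D V)" if "V \<in> \<B>" for V
  proof -
    have "(?pre V - U V) \<union> (U V - ?pre V) \<subseteq> topspace X"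
      using U(1)[OF that] openin_subset by blast
    then show ?thesis
      using U(2)[OF that] unfolding comeagre_in_def D_def by (simp add: double_diff)
  qed
  then have C: "comeagre_in X C"
    unfolding C_def using \<B>(1) by (intro comeagre_in_countable_INT)
  have CX: "C \<subseteq> topspace X"
    by (simp add: C_def)
  have "continuous_map (subtopology X C) Y f"
    unfolding continuous_map_eq_topcontinuous_at
  proof
    fix x assume "x \<in> topspace (subtopology X C)"
    then have x: "x \<in> C" "x \<in> topspace X"
      by auto
    have fY: "f \<in> topspace (subtopology X C) \<rightarrow> topspace Y"
      using f by (auto simp: baire_measurable_map_def)
    show "topcontinuous_at (subtopology X C) Y f x"
      unfolding topcontinuous_at_def
    proof (intro conjI allI impI)
      fix W assume "openin Y W \<and> f x \<in> W"
      then obtain V where V: "V \<in> \<B>" "f x \<in> V" "V \<subseteq> W"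
        using \<B>(3) by blast
      have agree: "y \<in> U V \<longleftrightarrow> f y \<in> V" if "y \<in> C" for y
      proof -
        have "y \<in> topspace X" "y \<in> D V"
          using that V(1) unfolding C_def by blast+
        then show ?thesis
          by (auto simp: D_def)
      qed
      have "openin (subtopology X C) (C \<inter> U V)"
        using U(1) V(1) by (simp add: openin_subtopology_Int2)
      then show "\<exists>U. openin (subtopology X C) U \<and> x \<in> U \<and> (\<forall>y\<in>U. f y \<in> W)"
        using agree x V by (intro exI[of _ "C \<inter> U V"]) auto
    qed (use x fY in auto)
  qed
  with C show thesis
    by (rule that)
qed

lemma continuous_map_sequentiallyI:
  assumes "metrizable_space X"
    and seq: "\<And>\<sigma> x. x \<in> topspace X \<Longrightarrow> range \<sigma> \<subseteq> topspace X \<Longrightarrow> limitin X \<sigma> x sequentially \<Longrightarrow>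
      limitin Y (f \<circ> \<sigma>) (f x) sequentially"
  shows "continuous_map X Y f"
proof -
  obtain M d where "Metric_space M d" and X: "X = Metric_space.mtopology M d"
    using assms(1) unfolding metrizable_space_def by blast
  then interpret Metric_space M d
    by simp
  show ?thesis
    unfolding continuous_map_atin
  proof
    fix x assume x: "x \<in> topspace X"
    \<comment> \<open>The constant sequence shows that \<open>f x\<close> lies in \<open>Y\<close>.\<close>
    have "limitin X (\<lambda>n. x) x sequentially"
      using x by simp
    then have "f x \<in> topspace Y"
      using seq[of x "\<lambda>n. x"] x by (auto dest: limitin_topspace)
    moreover have "eventually (\<lambda>y. f y \<in> U) (atin X x)" if "openin Y U" "f x \<in> U" for U
      unfolding X eventually_atin_sequentially
    proof (intro allI impI)
      fix \<sigma> :: "nat \<Rightarrow> 'a"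
      assume "range \<sigma> \<subseteq> M - {x} \<and> limitin mtopology \<sigma> x sequentially"
      then have "limitin Y (f \<circ> \<sigma>) (f x) sequentially"
        using x by (intro seq) (auto simp: X)
      then show "eventually (\<lambda>n. f (\<sigma> n) \<in> U) sequentially"
        using that by (auto simp: limitin_def)
    qed
    ultimately show "limitin Y f (f x) (atin X x)"
      by (simp add: limitin_def)
  qed
qed

text \<open>
  This consequence of Baire measurability is the form in which it is used: it passes to
  pointwise products and to translates by intersecting the comeagre sets involved.
\<close>

definition continuous_on_comeagre :: "'a topology \<Rightarrow> 'b topology \<Rightarrow> ('a \<Rightarrow> 'b) \<Rightarrow> bool" where
  "continuous_on_comeagre X Y f \<longleftrightarrow> f \<in> topspace X \<rightarrow> topspace Y \<and>
     (\<exists>C. comeagre_in X C \<and> continuous_map (subtopology X C) Y f)"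

section \<open>Polish groups and their actions\<close>

context polish_group
begin

lemma continuous_map_mult:
  "continuous_map Z T a \<Longrightarrow> continuous_map Z T b \<Longrightarrow> continuous_map Z T (\<lambda>z. a z \<otimes> b z)"
  using continuous_map_compose[OF continuous_map_pairedI continuous_mult, of Z a b]
  by (simp add: o_def)

lemma continuous_map_inverse:
  "continuous_map Z T a \<Longrightarrow> continuous_map Z T (\<lambda>z. inv (a z))"
  using continuous_map_compose[OF _ continuous_inv, of Z a] by (simp add: o_def)

lemma limitin_mult:
  assumes "limitin T a l F" "limitin T b m F"
  shows "limitin T (\<lambda>n. a n \<otimes> b n) (l \<otimes> m) F"
proof -
  have "limitin (prod_topology T T) (\<lambda>n. (a n, b n)) (l, m) F"
    using assms by (simp add: limitin_pairwise o_def)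
  from continuous_map_limit[OF continuous_mult this] show ?thesis
    by (simp add: o_def)
qed

lemma nonempty_topspace: "topspace T \<noteq> {}"
  using one_closed unfolding topspace_eq_carrier by blast

lemma homeomorphic_map_left_mult:
  assumes "g \<in> carrier G"
  shows "homeomorphic_map T T (\<lambda>h. g \<otimes> h)"
proof -
  have "continuous_map T T (\<lambda>h. a \<otimes> h)" if "a \<in> carrier G" for a
    using that by (intro continuous_map_mult) (auto simp: topspace_eq_carrier)
  then have "homeomorphic_maps T T (\<lambda>h. g \<otimes> h) (\<lambda>h. inv g \<otimes> h)"
    using assms by (auto simp: homeomorphic_maps_def topspace_eq_carrier m_assoc[symmetric])
  then show ?thesis
    using homeomorphic_map_maps by blast
qed

lemma homeomorphic_map_right_mult:
  assumes "g \<in> carrier G"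
  shows "homeomorphic_map T T (\<lambda>h. h \<otimes> g)"
proof -
  have "continuous_map T T (\<lambda>h. h \<otimes> a)" if "a \<in> carrier G" for a
    using that by (intro continuous_map_mult) (auto simp: topspace_eq_carrier)
  then have "homeomorphic_maps T T (\<lambda>h. h \<otimes> g) (\<lambda>h. h \<otimes> inv g)"
    using assms by (auto simp: homeomorphic_maps_def topspace_eq_carrier m_assoc)
  then show ?thesis
    using homeomorphic_map_maps by blast
qed

text \<open>
  If \<open>g\<close> were missing from a subgroup containing a comeagre set \<open>C\<close>, the subgroup and its
  coset by the inverse of \<open>g\<close> would be disjoint and both comeagre, against the Baire category theorem.
\<close>

lemma subgroup_comeagre_eq_carrier:
  assumes F: "subgroup F G" and C: "comeagre_in T C" "C \<subseteq> F"
  shows "F = carrier G"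
proof
  show "F \<subseteq> carrier G"
    by (rule subgroup.subset[OF F])
  show "carrier G \<subseteq> F"
  proof
    fix g assume g: "g \<in> carrier G"
    have "comeagre_in T {h \<in> topspace T. g \<otimes> h \<in> C}"
      using homeomorphic_map_left_mult[OF g] C(1)
      by (intro comeagre_in_preimage[of T T])
         (auto simp: homeomorphic_imp_continuous_map homeomorphic_imp_open_map)
    from comeagre_in_Int[OF C(1) this] obtain h where h: "h \<in> C" "h \<in> carrier G" "g \<otimes> h \<in> C"
      using comeagre_in_nonempty[OF _ nonempty_topspace] polish
      by (fastforce simp: polish_topology_def topspace_eq_carrier)
    have "(g \<otimes> h) \<otimes> inv h \<in> F"
      using h C(2) F by (meson subgroup.m_closed subgroup.m_inv_closed subsetD)
    then show "g \<in> F"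
      using g h by (simp add: m_assoc)
  qed
qed

end

context polish_group_action
begin

lemma action_closed: "g \<in> carrier G \<Longrightarrow> x \<in> topspace X \<Longrightarrow> \<alpha> g x \<in> topspace X"
  using element_image by blast

lemma continuous_map_action:
  "continuous_map Z T a \<Longrightarrow> continuous_map Z X b \<Longrightarrow> continuous_map Z X (\<lambda>z. \<alpha> (a z) (b z))"
  using continuous_map_compose[OF continuous_map_pairedI continuous_action, of Z a b]
  by (simp add: o_def)

lemma continuous_map_translation: "g \<in> carrier G \<Longrightarrow> continuous_map X X (\<alpha> g)"
  using continuous_map_action[of X "\<lambda>_. g" "\<lambda>x. x"] by (simp add: topspace_eq_carrier)

lemma homeomorphic_maps_translation:
  assumes "g \<in> carrier G"
  shows "homeomorphic_maps X X (\<alpha> g) (\<alpha> (inv g))"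
proof -
  have "\<alpha> (inv g) (\<alpha> g x) = x" "\<alpha> g (\<alpha> (inv g) x) = x" if "x \<in> topspace X" for x
    using orbit_sym_aux[OF assms that refl] orbit_sym_aux[OF inv_closed[OF assms] that refl]
      inv_inv[OF assms] by auto
  then show ?thesis
    using assms by (simp add: homeomorphic_maps_def continuous_map_translation)
qed

lemma open_map_translation: "g \<in> carrier G \<Longrightarrow> open_map X X (\<alpha> g)"
  using homeomorphic_maps_translation homeomorphic_map_maps homeomorphic_imp_open_map by blast

text \<open>
  Every single \<open>g \<in> V\<close> already provides a dense open set of such points, the preimage of \<open>U\<close>
  under the homeomorphism \<open>\<alpha> g\<close>.
\<close>

lemma comeagre_points_moved_into_dense_open:
  assumes U: "openin X U" "X closure_of U = topspace X"
    and V: "openin T V" "V \<noteq> {}"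
  shows "comeagre_in X {x \<in> topspace X. \<exists>g\<in>V. \<alpha> g x \<in> U}"
proof -
  have VG: "g \<in> carrier G" if "g \<in> V" for g
    using V(1) that openin_subset topspace_eq_carrier by blast
  let ?R = "\<lambda>g. {x \<in> topspace X. \<alpha> g x \<in> U}"
  have eq: "{x \<in> topspace X. \<exists>g\<in>V. \<alpha> g x \<in> U} = (\<Union>g\<in>V. ?R g)"
    by blast
  obtain g where g: "g \<in> V"
    using V(2) by blast
  have "comeagre_in X (?R g)"
    using comeagre_in_preimage[OF continuous_map_translation open_map_translation
        comeagre_in_open_dense[OF U]] VG[OF g] by simp
  then show ?thesis
    unfolding eq by (rule comeagre_in_mono) (use g in auto)
qed

text \<open>
  The Kuratowski--Ulam argument for \<open>{(g, x). \<alpha> g x \<in> C}\<close>. The set \<open>C\<close> contains a countable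
  intersection of dense open sets \<open>U\<close>. The return set of \<open>x\<close> to \<open>U\<close> is
  open, and it is dense as soon as it meets every nonempty basic open \<open>V \<subseteq> G\<close>. For each pair
  \<open>(U, V)\<close> this holds for a comeagre set of \<open>x\<close>, hence for some \<open>x\<close> it holds for all pairs.
\<close>

lemma comeagre_return_set_somewhere:
  assumes C: "comeagre_in X C" and "topspace X \<noteq> {}"
  obtains x where "x \<in> topspace X" "comeagre_in T {g \<in> carrier G. \<alpha> g x \<in> C}"
proof -
  obtain \<U> where \<U>: "countable \<U>"
    "\<And>U. U \<in> \<U> \<Longrightarrow> openin X U \<and> X closure_of U = topspace X" "topspace X \<inter> \<Inter>\<U> \<subseteq> C"
    using C unfolding comeagre_in_iff by blast
  obtain \<B> where \<B>: "countable \<B>" "\<And>V. V \<in> \<B> \<Longrightarrow> openin T V"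
    "\<And>U g. openin T U \<Longrightarrow> g \<in> U \<Longrightarrow> \<exists>V\<in>\<B>. g \<in> V \<and> V \<subseteq> U"
    using polish unfolding polish_topology_def second_countable_def by metis
  let ?D = "\<lambda>(U, V). {x \<in> topspace X. \<exists>g\<in>V. \<alpha> g x \<in> U}"
  have "comeagre_in X (?D p)" if "p \<in> \<U> \<times> (\<B> - {{}})" for p
  proof -
    obtain U V where p: "p = (U, V)" "U \<in> \<U>" "V \<in> \<B>" "V \<noteq> {}"
      using \<open>p \<in> \<U> \<times> (\<B> - {{}})\<close> by blast
    then show ?thesis
      using comeagre_points_moved_into_dense_open[of U V] \<U>(2)[of U] \<B>(2)[of V] by simp
  qed
  then have "comeagre_in X (topspace X \<inter> (\<Inter>p\<in>\<U> \<times> (\<B> - {{}}). ?D p))"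
    using \<U>(1) \<B>(1) by (intro comeagre_in_countable_INT) auto
  then have "topspace X \<inter> (\<Inter>p\<in>\<U> \<times> (\<B> - {{}}). ?D p) \<noteq> {}"
    using comeagre_in_nonempty[OF _ assms(2)] polish_space
    unfolding polish_topology_def by blast
  then obtain x where x: "x \<in> topspace X" and xD: "\<And>p. p \<in> \<U> \<times> (\<B> - {{}}) \<Longrightarrow> x \<in> ?D p"
    by blast
  have meet: "\<exists>g\<in>V. \<alpha> g x \<in> U" if "U \<in> \<U>" "V \<in> \<B>" "V \<noteq> {}" for U V
    using xD[of "(U, V)"] that by simp
  let ?R = "\<lambda>U. {g \<in> carrier G. \<alpha> g x \<in> U}"
  have "comeagre_in T (?R U)" if U: "U \<in> \<U>" for U
  proof (rule comeagre_in_open_dense)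
    have "continuous_map T X (\<lambda>g. \<alpha> g x)"
      using continuous_map_action[of T "\<lambda>g. g" "\<lambda>_. x"] x by simp
    from openin_continuous_map_preimage[OF this] show "openin T (?R U)"
      using \<U>(2)[OF U] by (simp add: topspace_eq_carrier)
    show "T closure_of ?R U = topspace T"
      unfolding dense_intersects_open
    proof (intro allI impI)
      fix W assume W: "openin T W \<and> W \<noteq> {}"
      then obtain V where V: "V \<in> \<B>" "V \<noteq> {}" "V \<subseteq> W"
        using \<B>(3) by blast
      then obtain g where "g \<in> V" "\<alpha> g x \<in> U"
        using meet U by blast
      then show "?R U \<inter> W \<noteq> {}"
        using V W openin_subset topspace_eq_carrier by blast
    qed
  qed
  then have "comeagre_in T (topspace T \<inter> (\<Inter>U\<in>\<U>. ?R U))"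
    using \<U>(1) by (intro comeagre_in_countable_INT)
  then have "comeagre_in T {g \<in> carrier G. \<alpha> g x \<in> C}"
    by (rule comeagre_in_mono) (use \<U>(3) x action_closed in \<open>auto simp: topspace_eq_carrier\<close>)
  with x show thesis
    by (rule that)
qed

text \<open>
  If \<open>y = \<alpha> h x\<close>, then \<open>g\<close> moves \<open>y\<close> into \<open>C\<close> exactly if \<open>g \<otimes> h\<close> moves \<open>x\<close> into \<open>C\<close>, so the return
  sets of points in one orbit are right translates of each other.
\<close>

lemma comeagre_return_set:
  assumes trans: "transitive_action G (topspace X) \<alpha>"
    and C: "comeagre_in X C" and y: "y \<in> topspace X"
  shows "comeagre_in T {g \<in> carrier G. \<alpha> g y \<in> C}"
proof -
  obtain x where x: "x \<in> topspace X" "comeagre_in T {g \<in> carrier G. \<alpha> g x \<in> C}"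
    using comeagre_return_set_somewhere[OF C] y by blast
  obtain h where h: "h \<in> carrier G" "\<alpha> h x = y"
    using transitive_action.unique_orbit[OF trans x(1) y] by blast
  have "comeagre_in T {g \<in> topspace T. g \<otimes> h \<in> {g \<in> carrier G. \<alpha> g x \<in> C}}"
    using homeomorphic_map_right_mult[OF h(1)] x(2)
    by (intro comeagre_in_preimage[of T T])
       (auto simp: homeomorphic_imp_continuous_map homeomorphic_imp_open_map)
  moreover have "\<alpha> (g \<otimes> h) x = \<alpha> g y" if "g \<in> carrier G" for g
    using that h x(1) composition_rule by simp
  ultimately show ?thesis
    by (elim back_subst[where P = "comeagre_in T"]) (use h in \<open>auto simp: topspace_eq_carrier\<close>)
qed

end

section \<open>Differentials\<close>

locale transitive_polish_action_differential =
  polish_group_action G T X \<alpha> + transitive_action G "topspace X" \<alpha> + H: polish_group H TH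
  for G (structure) and T and X and \<alpha> and H (structure) and TH
begin

abbreviation D where "D \<equiv> directional_differential H \<alpha>"

lemma D_apply: "D g \<psi> x = inv\<^bsub>H\<^esub> (\<psi> (\<alpha> g x)) \<otimes>\<^bsub>H\<^esub> \<psi> x"
  by (simp add: directional_differential_def differential_def)

lemma continuous_map_D:
  assumes "g \<in> carrier G" "continuous_map X TH \<psi>"
  shows "continuous_map X TH (D g \<psi>)"
  unfolding D_apply
  using assms continuous_map_compose[OF continuous_map_translation assms(2)]
  by (intro H.continuous_map_mult H.continuous_map_inverse) (auto simp: o_def)

text \<open>
  The cocycle identity: insert \<open>\<psi> (\<alpha> h x)\<close> and its inverse between the two factors.
\<close>

lemma D_mult:
  assumes \<psi>: "\<psi> \<in> topspace X \<rightarrow> carrier H"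
    and g: "g \<in> carrier G" "h \<in> carrier G" and x: "x \<in> topspace X"
  shows "D (g \<otimes> h) \<psi> x = D g \<psi> (\<alpha> h x) \<otimes>\<^bsub>H\<^esub> D h \<psi> x"
proof -
  have "\<alpha> (g \<otimes> h) x = \<alpha> g (\<alpha> h x)"
    using x g by (rule composition_rule)
  moreover have "\<psi> x \<in> carrier H" "\<psi> (\<alpha> h x) \<in> carrier H" "\<psi> (\<alpha> g (\<alpha> h x)) \<in> carrier H"
    using assms action_closed by auto
  moreover have "\<psi> (\<alpha> h x) \<otimes>\<^bsub>H\<^esub> (inv\<^bsub>H\<^esub> \<psi> (\<alpha> h x) \<otimes>\<^bsub>H\<^esub> \<psi> x) = \<psi> x"
    using calculation(2,3) by (simp add: H.m_assoc[symmetric])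
  ultimately show ?thesis
    by (simp add: D_apply H.m_assoc)
qed

lemma D_inverse:
  assumes \<psi>: "\<psi> \<in> topspace X \<rightarrow> carrier H" and g: "g \<in> carrier G" and x: "x \<in> topspace X"
  shows "D (inv g) \<psi> x = inv\<^bsub>H\<^esub> (D g \<psi> (\<alpha> (inv g) x))"
proof -
  have "\<alpha> g (\<alpha> (inv g) x) = x"
    using orbit_sym_aux[OF inv_closed[OF g] x refl] g by simp
  moreover have "\<psi> x \<in> carrier H" "\<psi> (\<alpha> (inv g) x) \<in> carrier H"
    using assms action_closed by auto
  ultimately show ?thesis
    by (simp add: D_apply H.inv_mult_group)
qed

text \<open>
  Continuity of a differential is preserved by translating its argument, so the cocycle identity
  gives closure under products, and the formula for inverses gives closure under inverses.
\<close>

lemma subgroup_continuous_D: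
  assumes \<psi>: "\<psi> \<in> topspace X \<rightarrow> carrier H"
  shows "subgroup {g \<in> carrier G. continuous_map X TH (D g \<psi>)} G"
proof (rule subgroupI)
  have "D \<one> \<psi> x = \<one>\<^bsub>H\<^esub>" if "x \<in> topspace X" for x
  proof -
    have "\<alpha> \<one> x = x"
      using id_eq_one that by (metis restrict_apply')
    then show ?thesis
      using \<psi> that by (simp add: D_apply Pi_iff)
  qed
  moreover have "continuous_map X TH (\<lambda>_. \<one>\<^bsub>H\<^esub>)"
    by (simp add: H.topspace_eq_carrier)
  ultimately have "continuous_map X TH (D \<one> \<psi>)"
    by (metis (no_types, lifting) continuous_map_eq)
  then have "\<one> \<in> {g \<in> carrier G. continuous_map X TH (D g \<psi>)}"
    by simp
  then show "{g \<in> carrier G. continuous_map X TH (D g \<psi>)} \<noteq> {}"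
    by (metis empty_iff)
next
  fix g assume "g \<in> {g \<in> carrier G. continuous_map X TH (D g \<psi>)}"
  then have g: "g \<in> carrier G" "continuous_map X TH (D g \<psi>)"
    by auto
  have "continuous_map X TH (\<lambda>x. inv\<^bsub>H\<^esub> (D g \<psi> (\<alpha> (inv g) x)))"
    using continuous_map_compose[OF continuous_map_translation g(2), of "inv g"] g(1)
    by (intro H.continuous_map_inverse) (simp add: o_def)
  then have "continuous_map X TH (D (inv g) \<psi>)"
    by (rule continuous_map_eq) (use D_inverse \<psi> g in auto)
  then show "inv g \<in> {g \<in> carrier G. continuous_map X TH (D g \<psi>)}"
    using g by simp
next
  fix g h assume "g \<in> {g \<in> carrier G. continuous_map X TH (D g \<psi>)}"
    and "h \<in> {g \<in> carrier G. continuous_map X TH (D g \<psi>)}"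
  then have g: "g \<in> carrier G" "continuous_map X TH (D g \<psi>)"
    and h: "h \<in> carrier G" "continuous_map X TH (D h \<psi>)"
    by auto
  have "continuous_map X TH (\<lambda>x. D g \<psi> (\<alpha> h x) \<otimes>\<^bsub>H\<^esub> D h \<psi> x)"
    using continuous_map_compose[OF continuous_map_translation g(2), of h] h
    by (intro H.continuous_map_mult) (simp_all add: o_def)
  then have "continuous_map X TH (D (g \<otimes> h) \<psi>)"
    by (rule continuous_map_eq) (use D_mult \<psi> g h in auto)
  then show "g \<otimes> h \<in> {g \<in> carrier G. continuous_map X TH (D g \<psi>)}"
    using g h by simp
qed auto

text \<open>
  A convergent sequence and its limit are countably many points, so one \<open>g\<close> moves them all into the
  set \<open>C\<close> on which \<open>\<psi>\<close> is continuous. The limit can be taken there and carried back, because \<open>\<psi>\<close>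
  and its translate by \<open>g\<close> differ by the continuous factor \<open>D g \<psi>\<close>.
\<close>

lemma continuous_if_all_D_continuous:
  assumes \<psi>: "continuous_on_comeagre X TH \<psi>"
    and D: "\<And>g. g \<in> carrier G \<Longrightarrow> continuous_map X TH (D g \<psi>)"
  shows "continuous_map X TH \<psi>"
proof (rule continuous_map_sequentiallyI)
  show "metrizable_space X"
    using polish_space completely_metrizable_imp_metrizable_space
    by (auto simp: polish_topology_def)
  fix \<sigma> x assume x: "x \<in> topspace X" and \<sigma>: "range \<sigma> \<subseteq> topspace X"
    and lim: "limitin X \<sigma> x sequentially"
  obtain C where C: "comeagre_in X C" "continuous_map (subtopology X C) TH \<psi>"
    using \<psi> by (auto simp: continuous_on_comeagre_def)
  have \<psi>H: "\<psi> y \<in> carrier H" if "y \<in> topspace X" for y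
    using \<psi> that by (auto simp: continuous_on_comeagre_def H.topspace_eq_carrier)
  let ?Y = "insert x (range \<sigma>)"
  have "comeagre_in T (topspace T \<inter> (\<Inter>y\<in>?Y. {g \<in> carrier G. \<alpha> g y \<in> C}))"
    using x \<sigma> C(1) transitive_action_axioms
    by (intro comeagre_in_countable_INT comeagre_return_set) auto
  from comeagre_in_nonempty[OF _ nonempty_topspace this]
  obtain g where g: "g \<in> carrier G" and gC: "\<And>y. y \<in> ?Y \<Longrightarrow> \<alpha> g y \<in> C"
    using polish by (auto simp: polish_topology_def)
  \<comment> \<open>Convergence in \<open>X\<close> becomes convergence within \<open>C\<close>, as \<open>g\<close> moves every point involved into \<open>C\<close>.\<close>
  have "limitin X (\<alpha> g \<circ> \<sigma>) (\<alpha> g x) sequentially"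
    using continuous_map_limit[OF continuous_map_translation[OF g] lim] .
  then have "limitin (subtopology X C) (\<alpha> g \<circ> \<sigma>) (\<alpha> g x) sequentially"
    using gC by (auto simp: limitin_subtopology)
  then have "limitin TH (\<psi> \<circ> (\<alpha> g \<circ> \<sigma>)) (\<psi> (\<alpha> g x)) sequentially"
    by (rule continuous_map_limit[OF C(2)])
  moreover have "limitin TH (D g \<psi> \<circ> \<sigma>) (D g \<psi> x) sequentially"
    by (rule continuous_map_limit[OF D[OF g] lim])
  ultimately have "limitin TH (\<lambda>n. (\<psi> \<circ> (\<alpha> g \<circ> \<sigma>)) n \<otimes>\<^bsub>H\<^esub> (D g \<psi> \<circ> \<sigma>) n)
      (\<psi> (\<alpha> g x) \<otimes>\<^bsub>H\<^esub> D g \<psi> x) sequentially"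
    by (rule H.limitin_mult)
  moreover have recover: "\<psi> (\<alpha> g y) \<otimes>\<^bsub>H\<^esub> D g \<psi> y = \<psi> y" if "y \<in> topspace X" for y
    using \<psi>H that g action_closed by (simp add: D_apply H.m_assoc[symmetric])
  ultimately show "limitin TH (\<psi> \<circ> \<sigma>) (\<psi> x) sequentially"
    using x \<sigma> by (simp add: o_def image_subset_iff)
qed

lemma continuous_on_comeagre_D:
  assumes \<psi>: "continuous_on_comeagre X TH \<psi>" and g: "g \<in> carrier G"
  shows "continuous_on_comeagre X TH (D g \<psi>)"
proof -
  obtain C where C: "comeagre_in X C" "continuous_map (subtopology X C) TH \<psi>"
    using \<psi> by (auto simp: continuous_on_comeagre_def)
  let ?C = "C \<inter> {x \<in> topspace X. \<alpha> g x \<in> C}"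
  have "comeagre_in X ?C"
    using g C(1) by (intro comeagre_in_Int comeagre_in_preimage[of X X]
        continuous_map_translation open_map_translation)
  moreover have "continuous_map (subtopology X ?C) TH (D g \<psi>)"
  proof -
    have "continuous_map (subtopology X ?C) (subtopology X C) (\<alpha> g)"
      using continuous_map_translation[OF g]
      by (auto simp: continuous_map_in_subtopology intro: continuous_map_from_subtopology)
    from continuous_map_compose[OF this C(2)]
    have "continuous_map (subtopology X ?C) TH (\<lambda>x. \<psi> (\<alpha> g x))"
      by (simp add: o_def)
    moreover have "continuous_map (subtopology X ?C) TH \<psi>"
      by (rule continuous_map_from_subtopology_mono[OF C(2)]) auto
    ultimately show ?thesis
      unfolding D_apply by (intro H.continuous_map_mult H.continuous_map_inverse)
  qed
  moreover have "D g \<psi> \<in> topspace X \<rightarrow> topspace TH"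
    using \<psi> g action_closed
    by (fastforce simp: continuous_on_comeagre_def H.topspace_eq_carrier D_apply)
  ultimately show ?thesis
    by (auto simp: continuous_on_comeagre_def)
qed

text \<open>
  Among the functions continuous on a comeagre set, a discontinuous one always has a discontinuous
  differential of the same kind, so bad directions can be chosen one after the other.
\<close>

lemma discontinuous_iterated_differentials:
  assumes \<phi>: "continuous_on_comeagre X TH \<phi>" and disc: "\<not> continuous_map X TH \<phi>"
  obtains g :: "nat \<Rightarrow> 'a" where "\<And>i. g i \<in> carrier G"
    "\<And>n. \<not> continuous_map X TH (iterated_differential H \<alpha> g n \<phi>)"
proof -
  let ?bad = "\<lambda>\<psi>. continuous_on_comeagre X TH \<psi> \<and> \<not> continuous_map X TH \<psi>"
  have "\<exists>g\<in>carrier G. ?bad (D g \<psi>)" if "?bad \<psi>" for \<psi>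
    using that continuous_if_all_D_continuous continuous_on_comeagre_D by blast
  then obtain \<gamma> where \<gamma>: "\<And>\<psi>. ?bad \<psi> \<Longrightarrow> \<gamma> \<psi> \<in> carrier G \<and> ?bad (D (\<gamma> \<psi>) \<psi>)"
    by metis
  define \<psi> where "\<psi> = rec_nat \<phi> (\<lambda>_ \<psi>. D (\<gamma> \<psi>) \<psi>)"
  have \<psi>: "\<psi> 0 = \<phi>" "\<psi> (Suc n) = D (\<gamma> (\<psi> n)) (\<psi> n)" for n
    by (simp_all add: \<psi>_def)
  \<comment> \<open>Directions are counted from 1, so \<open>g i\<close> is chosen for the differential of order \<open>i - 1\<close>.\<close>
  define g where "g i = \<gamma> (\<psi> (i - 1))" for i :: nat
  have bad: "?bad (\<psi> n)" for n
    by (induction n) (use \<phi> disc \<gamma> in \<open>auto simp: \<psi>\<close>)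
  have "iterated_differential H \<alpha> g n \<phi> = \<psi> n" for n
    by (induction n) (simp_all add: \<psi> g_def)
  with bad \<gamma> show thesis
    by (intro that[of g]) (auto simp: g_def)
qed

end

section \<open>Equivalent forms of continuity\<close>

theorem theorem1p3:
  fixes G :: "('g, 'm) monoid_scheme" and TG :: "'g topology"
    and H :: "('h, 'n) monoid_scheme" and TH :: "'h topology"
    and X :: "'x topology" and \<alpha> :: "'g \<Rightarrow> 'x \<Rightarrow> 'x" and \<phi> :: "'x \<Rightarrow> 'h"
  assumes "polish_group_action G TG X \<alpha>"
    and "transitive_action G (topspace X) \<alpha>"
    and "polish_group H TH"
    and "baire_measurable_map X TH \<phi>"
  shows "(continuous_map X TH \<phi> \<longleftrightarrow>
            continuous_map (prod_topology TG X) TH (differential H \<alpha> \<phi>)) \<and>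
         (continuous_map X TH \<phi> \<longleftrightarrow>
            (\<exists>C. comeagre_in TG C \<and>
                 (\<forall>g\<in>C. continuous_map X TH (directional_differential H \<alpha> g \<phi>)))) \<and>
         (continuous_map X TH \<phi> \<longleftrightarrow>
            (\<forall>F. subgroup F G \<and> F \<noteq> carrier G \<longrightarrow>
                 (\<exists>g \<in> carrier G - F. continuous_map X TH (directional_differential H \<alpha> g \<phi>)))) \<and>
         (continuous_map X TH \<phi> \<longleftrightarrow>
            (\<forall>g :: nat \<Rightarrow> 'g. (\<forall>i\<ge>1. g i \<in> carrier G) \<longrightarrow>
                 (\<exists>n\<ge>1. continuous_map X TH (iterated_differential H \<alpha> g n \<phi>))))"
proof -
  interpret A: polish_group_action G TG X \<alpha>
    by fact
  interpret transitive_action G "topspace X" \<alpha>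
    by fact
  interpret H: polish_group H TH
    by fact
  interpret transitive_polish_action_differential G TG X \<alpha> H TH ..
  have \<phi>: "continuous_on_comeagre X TH \<phi>"
    using assms(4) baire_measurable_imp_continuous_on_comeagre[OF _ assms(4)] H.polish
    unfolding continuous_on_comeagre_def baire_measurable_map_def polish_topology_def by metis
  then have \<phi>H: "\<phi> \<in> topspace X \<rightarrow> carrier H"
    by (auto simp: continuous_on_comeagre_def H.topspace_eq_carrier)
  let ?c1 = "continuous_map X TH \<phi>"
  let ?c2 = "continuous_map (prod_topology TG X) TH (differential H \<alpha> \<phi>)"
  let ?c3 = "\<exists>C. comeagre_in TG C \<and> (\<forall>g\<in>C. continuous_map X TH (D g \<phi>))"
  let ?c4 = "\<forall>F. subgroup F G \<and> F \<noteq> carrier G \<longrightarrow>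
                 (\<exists>g \<in> carrier G - F. continuous_map X TH (D g \<phi>))"
  let ?c5 = "\<forall>g :: nat \<Rightarrow> 'g. (\<forall>i\<ge>1. g i \<in> carrier G) \<longrightarrow>
                 (\<exists>n\<ge>1. continuous_map X TH (iterated_differential H \<alpha> g n \<phi>))"
  have 12: "?c2" if "?c1"
  proof -
    have "continuous_map (prod_topology TG X) X (\<lambda>p. \<alpha> (fst p) (snd p))"
      by (intro A.continuous_map_action continuous_map_fst continuous_map_snd)
    from continuous_map_compose[OF this that] continuous_map_compose[OF continuous_map_snd that]
    show ?thesis
      unfolding differential_def case_prod_beta
      by (intro H.continuous_map_mult H.continuous_map_inverse) (simp_all add: o_def)
  qed
  have 23: "?c3" if "?c2"
  proof -
    have "continuous_map X TH (D g \<phi>)" if "g \<in> carrier G" for g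
    proof -
      have "continuous_map X (prod_topology TG X) (\<lambda>x. (g, x))"
        using that by (intro continuous_map_pairedI) (auto simp: A.topspace_eq_carrier)
      from continuous_map_compose[OF this \<open>?c2\<close>] show ?thesis
        by (simp add: o_def directional_differential_def)
    qed
    then show ?thesis
      using comeagre_in_topspace[of TG] A.topspace_eq_carrier by auto
  qed
  have 34: "?c4" if c3: "?c3"
  proof (intro allI impI)
    fix F assume F: "subgroup F G \<and> F \<noteq> carrier G"
    obtain C where C: "comeagre_in TG C" "\<And>g. g \<in> C \<Longrightarrow> continuous_map X TH (D g \<phi>)"
      using c3 by blast
    have "\<not> C \<subseteq> F"
      using A.subgroup_comeagre_eq_carrier C(1) F by blast
    moreover have "C \<subseteq> carrier G"
      using C(1) by (simp add: comeagre_in_def A.topspace_eq_carrier)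
    ultimately show "\<exists>g \<in> carrier G - F. continuous_map X TH (D g \<phi>)"
      using C(2) by blast
  qed
  \<comment> \<open>The directions of continuity form a subgroup, to which the hypothesis applies if it is proper.\<close>
  have 41: "?c1" if "?c4"
  proof (rule continuous_if_all_D_continuous[OF \<phi>])
    have "{g \<in> carrier G. continuous_map X TH (D g \<phi>)} = carrier G"
      using that subgroup_continuous_D[OF \<phi>H] by blast
    then show "continuous_map X TH (D g \<phi>)" if "g \<in> carrier G" for g
      using that by blast
  qed
  have 15: "?c5" if "?c1"
    using continuous_map_D[OF _ that] by (intro allI impI exI[of _ 1]) simp
  have 51: "?c1" if "?c5"
    using discontinuous_iterated_differentials[OF \<phi>] that by metis
  show ?thesis
    using 12 23 34 41 15 51 by blast
qed

end
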